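(* Let $\{\Re_m\}_{m\ge 0}$ be a sequence of positive linear operators from $C_{*}[0,\infty)$ to $B_{*}[0,\infty)$ such that $$\sum_{m=0}^{\infty}\left\Vert \Re_m\phi_0\right\Vert_\infty \frac{y^m}{m!}<\infty\quad\text{for every } y>0 .$$ If, for each $\nu=0,1,2$, $$\lim_{y\to\infty}e^{-y}\left\Vert \sum_{m=0}^{\infty}\left(\Re_m\phi_\nu-\phi_\nu\right)\frac{y^m}{m!}\right\Vert_\infty=0,$$ then for every $\phi\in C_{*}[0,\infty)$, $$\lim_{y\to\infty}e^{-y}\left\Vert \sum_{m=0}^{\infty}\left(\Re_m\phi-\phi\right)\frac{y^m}{m!}\right\Vert_\infty=0 .$$
   Context: $C_{*}[0,\infty)$ is the space of continuous real-valued functions $\phi$ on $[0,\infty)$ for which $\lim_{\xi\to\infty}\phi(\xi)$ exists (and is finite). $B_{*}[0,\infty)$ is the space of bounded real-valued functions on $[0,\infty)$ (not necessarily continuous) for which the limit at infinity exists. Both carry the norm $\|\phi\|_\infty=\sup_{\xi\ge 0}|\phi(\xi)|$. A linear operator is positive if it maps non-negative functions to non-negative functions. The test functions are $\phi_\nu(t)=e^{-\nu t}$, $\nu=0,1,2$. *)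

theory Defs
  imports "HOL-Analysis.Analysis"
begin

text \<open>
  A real function on \<open>[0,\<infinity>)\<close> is represented by a function of type \<open>real \<Rightarrow> real\<close> whose values at
  negative arguments are irrelevant: every notion below inspects functions on \<open>{0..}\<close> only.
\<close>

definition C_star :: "(real \<Rightarrow> real) set" where
  "C_star = {f. continuous_on {0..} f \<and> (\<exists>l. (f \<longlongrightarrow> l) at_top)}"

definition B_star :: "(real \<Rightarrow> real) set" where
  "B_star = {f. bounded (f ` {0..}) \<and> (\<exists>l. (f \<longlongrightarrow> l) at_top)}"

text \<open>\<open>sup_norm f\<close> is meaningful only if \<open>f\<close> is bounded on \<open>{0..}\<close>.\<close>

definition sup_norm :: "(real \<Rightarrow> real) \<Rightarrow> real" where
  "sup_norm f = (SUP x\<in>{0..}. \<bar>f x\<bar>)"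

definition positive_linear_operator :: "((real \<Rightarrow> real) \<Rightarrow> real \<Rightarrow> real) \<Rightarrow> bool" where
  "positive_linear_operator T \<longleftrightarrow>
     (\<forall>f\<in>C_star. T f \<in> B_star) \<and>
     (\<forall>f\<in>C_star. \<forall>g\<in>C_star. \<forall>x\<ge>0. T (\<lambda>t. f t + g t) x = T f x + T g x) \<and>
     (\<forall>c. \<forall>f\<in>C_star. \<forall>x\<ge>0. T (\<lambda>t. c * f t) x = c * T f x) \<and>
     (\<forall>f\<in>C_star. (\<forall>t\<ge>0. f t \<ge> 0) \<longrightarrow> (\<forall>x\<ge>0. T f x \<ge> 0))"

definition test_fun :: "nat \<Rightarrow> real \<Rightarrow> real" where
  "test_fun \<nu> t = exp (- real \<nu> * t)"

text \<open>
  Such operators are well defined on functions on \<open>[0,\<infinity>)\<close>: the choice of the representative does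
  not matter, so no separate congruence condition is needed.
\<close>

lemma C_star_lincomb:
  assumes f: "f \<in> C_star" and g: "g \<in> C_star"
  shows "(\<lambda>t. f t + c * g t) \<in> C_star"
proof -
  obtain k l where "(f \<longlongrightarrow> k) at_top" "(g \<longlongrightarrow> l) at_top"
    using f g by (auto simp: C_star_def)
  then have "((\<lambda>t. f t + c * g t) \<longlongrightarrow> k + c * l) at_top"
    by (intro tendsto_intros)
  moreover have "continuous_on {0..} (\<lambda>t. f t + c * g t)"
    using f g by (intro continuous_intros) (simp_all add: C_star_def)
  ultimately show ?thesis by (auto simp: C_star_def)
qed

lemma C_star_scale:
  assumes "f \<in> C_star"
  shows "(\<lambda>t. c * f t) \<in> C_star"
proof -
  have "(\<lambda>_. 0) \<in> C_star"
    unfolding C_star_def using tendsto_const by auto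
  from C_star_lincomb[OF this assms, of c] show ?thesis by simp
qed

lemma positive_linear_operator_mono:
  assumes T: "positive_linear_operator T"
    and f: "f \<in> C_star" and g: "g \<in> C_star"
    and le: "\<And>t. t \<ge> 0 \<Longrightarrow> f t \<le> g t"
    and x: "x \<ge> 0"
  shows "T f x \<le> T g x"
proof -
  have add: "\<forall>f\<in>C_star. \<forall>g\<in>C_star. \<forall>x\<ge>0. T (\<lambda>t. f t + g t) x = T f x + T g x"
    and scale: "\<forall>c. \<forall>f\<in>C_star. \<forall>x\<ge>0. T (\<lambda>t. c * f t) x = c * T f x"
    and pos: "\<forall>f\<in>C_star. (\<forall>t\<ge>0. f t \<ge> 0) \<longrightarrow> (\<forall>x\<ge>0. T f x \<ge> 0)"
    using T unfolding positive_linear_operator_def by - (elim conjE, assumption)+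
  have "0 \<le> T (\<lambda>t. g t + (-1) * f t) x"
    using pos[rule_format, OF C_star_lincomb[OF g f], of "-1" x] le x by simp
  also have "\<dots> = T g x + T (\<lambda>t. (-1) * f t) x"
    by (rule add[rule_format, OF g C_star_scale[OF f] x])
  also have "T (\<lambda>t. (-1) * f t) x = (-1) * T f x"
    by (rule scale[rule_format, OF f x])
  finally show ?thesis by simp
qed

lemma positive_linear_operator_cong:
  assumes T: "positive_linear_operator T"
    and f: "f \<in> C_star" and g: "g \<in> C_star"
    and eq: "\<And>t. t \<ge> 0 \<Longrightarrow> f t = g t"
    and x: "x \<ge> 0"
  shows "T f x = T g x"
proof (rule antisym)
  show "T f x \<le> T g x"
    by (rule positive_linear_operator_mono[OF T f g _ x]) (simp add: eq)
  show "T g x \<le> T f x"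
    by (rule positive_linear_operator_mono[OF T g f _ x]) (simp add: eq)
qed

end

(* Korovkin's argument: under s = exp(-t) the space C_star becomes C[0,1], so uniform continuity gives
   |phi t - phi x| <= e + C * (exp(-t) - exp(-x))^2. A positive functional therefore moves phi x
   by at most e plus a multiple of its errors on the three test functions. This bound is uniform over all
   positive functionals, and is applied, for each y > 0 and x >= 0, to the Borel mean
   f |-> exp(-y) * (SUM m. R m f x * y^m / m!), for which the error at f is exactly the quantity
   whose sup norm is to tend to 0. *)
theory Submission
  imports Defs
begin

section \<open>The sup norm and the change of variable s = exp(-x)\<close>

lemma le_sup_norm:
  assumes "bounded (f ` {0..})" "x \<ge> 0"
  shows "\<bar>f x\<bar> \<le> sup_norm f"
proof -
  obtain B where "\<And>t. t \<ge> 0 \<Longrightarrow> \<bar>f t\<bar> \<le> B"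
    using assms(1) by (auto simp: bounded_iff)
  then have "bdd_above ((\<lambda>t. \<bar>f t\<bar>) ` {0..})"
    by (intro bdd_aboveI2[where M = B]) auto
  then show ?thesis
    unfolding sup_norm_def using assms(2) by (intro cSUP_upper) auto
qed

lemma sup_norm_le: "sup_norm f \<le> c" if "\<And>x. x \<ge> 0 \<Longrightarrow> \<bar>f x\<bar> \<le> c"
  unfolding sup_norm_def using that by (intro cSUP_least) auto

text \<open>The map x |-> exp(-x) takes [0, infinity) onto (0,1], and the limit at infinity supplies
  the missing value at 0. Compactness of [0,1] then yields both boundedness and a uniform modulus of
  continuity.\<close>

lemma C_star_substitution:
  assumes "f \<in> C_star"
  obtains g where "continuous_on {0..1} g" "\<And>x. x \<ge> 0 \<Longrightarrow> f x = g (exp (- x))"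
proof -
  obtain l where cont: "continuous_on {0..} f" and lim: "(f \<longlongrightarrow> l) at_top"
    using assms by (auto simp: C_star_def)
  define g where "g s = (if s = 0 then l else f (- ln s))" for s
  have "continuous (at s within {0..1}) g" if s: "s \<in> {0..1}" for s
  proof (cases "s = 0")
    case True
    \<comment> \<open>Continuity at the added point 0 is exactly the convergence of \<open>f\<close>
      at infinity, read along -ln s.\<close>
    have "LIM s at_right 0. - ln (s::real) :> at_top"
      using ln_at_0 by (simp add: filterlim_uminus_at_top)
    then have "((\<lambda>s. f (- ln s)) \<longlongrightarrow> l) (at_right 0)"
      by (rule filterlim_compose[OF lim])
    moreover have "\<forall>\<^sub>F s in at_right 0. f (- ln s) = g s"
      by (simp add: g_def eventually_at_filter)
    ultimately have "(g \<longlongrightarrow> l) (at_right 0)"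
      by (rule Lim_transform_eventually)
    then have "(g \<longlongrightarrow> l) (at 0 within {0..1})"
      by (simp add: at_within_Icc_at_right)
    then show ?thesis
      using True by (simp add: continuous_within g_def)
  next
    case False
    then have "s \<in> {0<..1}" using s by auto
    have "continuous_on {0<..1::real} (\<lambda>s. f (- ln s))"
      by (intro continuous_on_compose2[OF cont]) (auto intro!: continuous_intros)
    then have "continuous_on {0<..1} g"
      by (rule continuous_on_eq) (auto simp: g_def)
    then have "continuous (at s within {0<..1}) g"
      using \<open>s \<in> {0<..1}\<close> by (simp add: continuous_on_eq_continuous_within)
    \<comment> \<open>The two sets agree on the open neighbourhood \<open>{0<..}\<close> of
      \<open>s\<close>, so they define the same filter.\<close>
    moreover have "at s within {0..1} = at s within {0<..1}"
      using \<open>s \<in> {0<..1}\<close> by (intro at_within_nhd[of s "{0<..}"]) auto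
    ultimately show ?thesis by simp
  qed
  then have "continuous_on {0..1} g"
    by (simp add: continuous_on_eq_continuous_within)
  then show thesis
    by (rule that) (simp add: g_def)
qed

lemma C_star_bounded:
  assumes "f \<in> C_star"
  shows "bounded (f ` {0..})"
proof -
  obtain g where g: "continuous_on {0..1} g" "\<And>x. x \<ge> 0 \<Longrightarrow> f x = g (exp (- x))"
    using C_star_substitution[OF assms] by blast
  have "bounded (g ` {0..1})"
    using g(1) by (intro compact_imp_bounded compact_continuous_image) auto
  moreover have "f ` {0..} \<subseteq> g ` {0..1}"
    using g(2) by auto
  ultimately show ?thesis by (rule bounded_subset)
qed

lemma test_fun_C_star: "test_fun \<nu> \<in> C_star"
proof -
  have "continuous_on {0..} (test_fun \<nu>)"
    unfolding test_fun_def by (intro continuous_intros)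
  moreover have "\<exists>l. (test_fun \<nu> \<longlongrightarrow> l) at_top"
  proof (cases "\<nu> = 0")
    case True
    then have "test_fun \<nu> = (\<lambda>_. 1)" by (auto simp: test_fun_def)
    then show ?thesis by (auto intro: tendsto_const)
  next
    case False
    then have "LIM t at_top. - real \<nu> * t :> at_bot"
      by (intro filterlim_tendsto_neg_mult_at_bot[OF tendsto_const _ filterlim_ident]) auto
    then have "(test_fun \<nu> \<longlongrightarrow> 0) at_top"
      unfolding test_fun_def by (rule filterlim_compose[OF exp_at_bot])
    then show ?thesis by blast
  qed
  ultimately show ?thesis by (simp add: C_star_def)
qed

lemma test_fun_0: "test_fun 0 = (\<lambda>_. 1)"
  by (auto simp: test_fun_def)

text \<open>If exp(-t) and exp(-x) are close, uniform continuity gives the bound \<open>e\<close>;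
  otherwise the quadratic term alone dominates the trivial bound 2M. A square is used because it
  expands into the three test functions.\<close>

lemma C_star_modulus:
  assumes f: "f \<in> C_star" and "e > 0"
  obtains C where "C \<ge> 0"
    "\<And>t x. t \<ge> 0 \<Longrightarrow> x \<ge> 0 \<Longrightarrow> \<bar>f t - f x\<bar> \<le> e + C * (exp (- t) - exp (- x))\<^sup>2"
proof -
  obtain g where g: "continuous_on {0..1} g" "\<And>x. x \<ge> 0 \<Longrightarrow> f x = g (exp (- x))"
    using C_star_substitution[OF f] by blast
  have "uniformly_continuous_on {0..1} g"
    using g(1) by (intro compact_uniformly_continuous) auto
  then obtain d where "d > 0"
    and d: "\<And>s s'. s \<in> {0..1} \<Longrightarrow> s' \<in> {0..1} \<Longrightarrow> \<bar>s' - s\<bar> < d \<Longrightarrow> \<bar>g s' - g s\<bar> < e"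
    using \<open>e > 0\<close> unfolding uniformly_continuous_on_def dist_real_def by metis
  obtain M where M: "\<And>t. t \<ge> 0 \<Longrightarrow> \<bar>f t\<bar> \<le> M"
    using C_star_bounded[OF f] by (auto simp: bounded_iff)
  have "M \<ge> 0" using M[of 0] by simp
  show thesis
  proof
    \<comment> \<open>With this factor the quadratic term is at least 2M as soon as the difference
      of exponentials reaches \<open>d\<close> in absolute value.\<close>
    show "2 * M / d\<^sup>2 \<ge> 0" using \<open>M \<ge> 0\<close> by simp
    fix t x :: real assume tx: "t \<ge> 0" "x \<ge> 0"
    let ?u = "exp (- t) - exp (- x)"
    show "\<bar>f t - f x\<bar> \<le> e + 2 * M / d\<^sup>2 * ?u\<^sup>2"
    proof (cases "\<bar>?u\<bar> < d")
      case True
      then have "\<bar>f t - f x\<bar> < e"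
        using d[of "exp (- x)" "exp (- t)"] g(2) tx by simp
      moreover have "2 * M / d\<^sup>2 * ?u\<^sup>2 \<ge> 0" using \<open>M \<ge> 0\<close> by simp
      ultimately show ?thesis by linarith
    next
      case False
      then have "d\<^sup>2 \<le> ?u\<^sup>2"
        using \<open>d > 0\<close> by (simp add: abs_le_square_iff[symmetric])
      then have "2 * M * 1 \<le> 2 * M * (?u\<^sup>2 / d\<^sup>2)"
        using \<open>d > 0\<close> \<open>M \<ge> 0\<close> by (intro mult_left_mono) auto
      then show ?thesis
        using M[OF tx(1)] M[OF tx(2)] \<open>e > 0\<close> by simp
    qed
  qed
qed

section \<open>Korovkin's estimate for a positive operator at one point\<close>

lemma positive_linear_operator_lincomb:
  assumes "positive_linear_operator T" "f \<in> C_star" "g \<in> C_star" "x \<ge> 0"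
  shows "T (\<lambda>t. f t + c * g t) x = T f x + c * T g x"
  using assms C_star_scale[OF assms(3), of c] by (simp add: positive_linear_operator_def)

lemma positive_linear_operator_abs_le:
  assumes T: "positive_linear_operator T" and f: "f \<in> C_star" and g: "g \<in> C_star"
    and le: "\<And>t. t \<ge> 0 \<Longrightarrow> \<bar>f t\<bar> \<le> g t" and x: "x \<ge> 0"
  shows "\<bar>T f x\<bar> \<le> T g x"
proof -
  have "T f x \<le> T g x"
    using le by (intro positive_linear_operator_mono[OF T f g _ x]) (simp add: abs_le_iff)
  moreover have "T (\<lambda>t. -1 * f t) x \<le> T g x"
    using le by (intro positive_linear_operator_mono[OF T C_star_scale[OF f] g _ x])
      (simp add: abs_le_iff)
  moreover have "T (\<lambda>t. -1 * f t) x = -1 * T f x"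
    using T f x unfolding positive_linear_operator_def by blast
  ultimately show ?thesis by linarith
qed

lemma korovkin_estimate:
  assumes f: "f \<in> C_star" and "e > 0"
  obtains C where "C \<ge> 0"
    "\<And>T x. positive_linear_operator T \<Longrightarrow> x \<ge> 0 \<Longrightarrow>
       \<bar>T f x - f x\<bar> \<le> e + C * (\<Sum>\<nu>\<le>2. \<bar>T (test_fun \<nu>) x - test_fun \<nu> x\<bar>)"
proof -
  obtain C where "C \<ge> 0" and C:
    "\<And>t x. t \<ge> 0 \<Longrightarrow> x \<ge> 0 \<Longrightarrow> \<bar>f t - f x\<bar> \<le> e + C * (exp (- t) - exp (- x))\<^sup>2"
    using C_star_modulus[OF f \<open>e > 0\<close>] by blast
  obtain M where M: "\<And>t. t \<ge> 0 \<Longrightarrow> \<bar>f t\<bar> \<le> M"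
    using C_star_bounded[OF f] by (auto simp: bounded_iff)
  have "M \<ge> 0" using M[of 0] by simp
  show thesis
  proof
    \<comment> \<open>The errors at the test functions 0, 1, 2 will have coefficients e + M + C, 2C
      and C; this is a common upper bound.\<close>
    show "e + M + 2 * C \<ge> 0" using \<open>e > 0\<close> \<open>M \<ge> 0\<close> \<open>C \<ge> 0\<close> by simp
    fix T and x :: real assume T: "positive_linear_operator T" and x: "x \<ge> 0"
    define d where "d \<nu> = T (test_fun \<nu>) x - test_fun \<nu> x" for \<nu>
    let ?s = "exp (- x)"
    have tf: "test_fun 0 x = 1" "test_fun 1 x = ?s" "test_fun 2 x = ?s\<^sup>2"
      by (simp_all add: test_fun_def power2_eq_square flip: exp_add)
    \<comment> \<open>\<open>?p\<close> is (exp(-t) - s)^2 without its constant term. That term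
      enters \<open>?q\<close> through \<open>test_fun 0\<close>, so that \<open>?q\<close> is the
      modulus bound and \<open>?h\<close> is f - f(x), both written as combinations on which
      \<open>T\<close> can be evaluated.\<close>
    let ?p = "\<lambda>t. test_fun 2 t + (- 2 * ?s) * test_fun 1 t"
    let ?q = "\<lambda>t. (e + C * ?s\<^sup>2) * test_fun 0 t + C * ?p t"
    let ?h = "\<lambda>t. f t + (- f x) * test_fun 0 t"
    note mem = test_fun_C_star C_star_lincomb C_star_scale
    have Tp: "T ?p x = T (test_fun 2) x + (- 2 * ?s) * T (test_fun 1) x"
      by (intro positive_linear_operator_lincomb T x mem)
    have "T ?q x = T (\<lambda>t. (e + C * ?s\<^sup>2) * test_fun 0 t) x + C * T ?p x"
      by (intro positive_linear_operator_lincomb T x mem)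
    also have "T (\<lambda>t. (e + C * ?s\<^sup>2) * test_fun 0 t) x = (e + C * ?s\<^sup>2) * T (test_fun 0) x"
      using T x test_fun_C_star unfolding positive_linear_operator_def by blast
    also note Tp
    finally have "T ?q x = (e + C * ?s\<^sup>2) * (d 0 + 1) + C * ((d 2 + ?s\<^sup>2) - 2 * ?s * (d 1 + ?s))"
      using tf by (simp add: d_def power2_eq_square)
    \<comment> \<open>The error-free terms in the factor of \<open>C\<close> cancel because the
      square vanishes at t = x.\<close>
    also have "\<dots> = e + e * d 0 + C * (d 2 - 2 * ?s * d 1 + ?s\<^sup>2 * d 0)"
      by (simp add: algebra_simps power2_eq_square)
    finally have Tq: "T ?q x = e + e * d 0 + C * (d 2 - 2 * ?s * d 1 + ?s\<^sup>2 * d 0)" .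
    have Th: "T ?h x = T f x + (- f x) * T (test_fun 0) x"
      by (intro positive_linear_operator_lincomb T x f mem)
    have "\<bar>T ?h x\<bar> \<le> T ?q x"
    proof (rule positive_linear_operator_abs_le[OF T _ _ _ x])
      show "?h \<in> C_star" by (intro f mem)
      show "?q \<in> C_star" by (intro mem)
      fix t :: real assume t: "t \<ge> 0"
      have "test_fun 2 t = (exp (- t))\<^sup>2" "test_fun 1 t = exp (- t)"
        by (simp_all add: test_fun_def power2_eq_square flip: exp_add)
      then have "?q t = e + C * (exp (- t) - ?s)\<^sup>2"
        by (simp add: test_fun_0 power2_eq_square algebra_simps)
      then show "\<bar>?h t\<bar> \<le> ?q t"
        using C[OF t x] by (simp add: test_fun_0)
    qed
    \<comment> \<open>\<open>T\<close> need not preserve constants; the last summand corrects for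
      this.\<close>
    moreover have "T f x - f x = T ?h x + f x * d 0"
      unfolding Th d_def by (simp add: test_fun_0 algebra_simps)
    moreover have "\<bar>f x * d 0\<bar> \<le> M * \<bar>d 0\<bar>"
      using M[OF x] by (simp add: abs_mult mult_right_mono)
    \<comment> \<open>Since 0 < s \<le> 1 for x \<ge> 0, the dependence of the coefficients on x
      disappears.\<close>
    moreover have "d 2 - 2 * ?s * d 1 + ?s\<^sup>2 * d 0 \<le> \<bar>d 2\<bar> + 2 * \<bar>d 1\<bar> + \<bar>d 0\<bar>"
    proof -
      have "\<bar>?s * d 1\<bar> \<le> 1 * \<bar>d 1\<bar>"
        unfolding abs_mult using x by (intro mult_right_mono) auto
      moreover have "\<bar>?s\<^sup>2 * d 0\<bar> \<le> 1 * \<bar>d 0\<bar>"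
        unfolding abs_mult using x by (intro mult_right_mono) (auto simp: power_le_one)
      ultimately show ?thesis
        unfolding mult.assoc[of 2 ?s] by linarith
    qed
    then have "C * (d 2 - 2 * ?s * d 1 + ?s\<^sup>2 * d 0) \<le> C * (\<bar>d 2\<bar> + 2 * \<bar>d 1\<bar> + \<bar>d 0\<bar>)"
      using \<open>C \<ge> 0\<close> by (rule mult_left_mono)
    moreover have "e * d 0 \<le> e * \<bar>d 0\<bar>"
      using \<open>e > 0\<close> by simp
    ultimately have "\<bar>T f x - f x\<bar>
        \<le> e + e * \<bar>d 0\<bar> + C * (\<bar>d 2\<bar> + 2 * \<bar>d 1\<bar> + \<bar>d 0\<bar>) + M * \<bar>d 0\<bar>"
      unfolding Tq by linarith
    also have "\<dots> \<le> \<dots> + (C * \<bar>d 0\<bar> + e * \<bar>d 1\<bar> + M * \<bar>d 1\<bar> + e * \<bar>d 2\<bar> + M * \<bar>d 2\<bar> + C * \<bar>d 2\<bar>)"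
      using \<open>e > 0\<close> \<open>M \<ge> 0\<close> \<open>C \<ge> 0\<close> by simp
    also have "\<dots> = e + (e + M + 2 * C) * (\<Sum>\<nu>\<le>2. \<bar>d \<nu>\<bar>)"
      by (simp add: numeral_2_eq_2 algebra_simps)
    finally show "\<bar>T f x - f x\<bar>
        \<le> e + (e + M + 2 * C) * (\<Sum>\<nu>\<le>2. \<bar>T (test_fun \<nu>) x - test_fun \<nu> x\<bar>)"
      by (simp only: d_def)
  qed
qed

section \<open>Borel means for a fixed parameter y\<close>

lemma sums_exp_fact: "(\<lambda>m. y ^ m / fact m) sums exp (y :: real)"
  using exp_converges[of y] by (simp add: divide_inverse mult.commute)

context
  fixes R :: "nat \<Rightarrow> (real \<Rightarrow> real) \<Rightarrow> real \<Rightarrow> real" and y :: real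
  assumes R: "\<And>m. positive_linear_operator (R m)"
    and y: "y > 0"
    and summable: "summable (\<lambda>m. sup_norm (R m (test_fun 0)) * (y ^ m / fact m))"
begin

text \<open>By positivity, |f| \<le> M * \<open>test_fun 0\<close> makes the assumed series a
  majorant, up to the factor \<open>M\<close>. The bound on the sum does not involve x, which later
  makes the error function bounded.\<close>

lemma operator_series_bounds:
  assumes f: "f \<in> C_star" and x: "x \<ge> 0" and M: "\<And>t. t \<ge> 0 \<Longrightarrow> \<bar>f t\<bar> \<le> M"
  shows "summable (\<lambda>m. R m f x * (y ^ m / fact m))"
    and "\<bar>\<Sum>m. R m f x * (y ^ m / fact m)\<bar>
           \<le> M * (\<Sum>m. sup_norm (R m (test_fun 0)) * (y ^ m / fact m))"
proof -
  let ?b = "\<lambda>m. M * (sup_norm (R m (test_fun 0)) * (y ^ m / fact m))"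
  have "M \<ge> 0" using M[of 0] by simp
  have le: "norm (R m f x * (y ^ m / fact m)) \<le> ?b m" for m
  proof -
    have "\<bar>R m f x\<bar> \<le> R m (\<lambda>t. M * test_fun 0 t) x"
      using M by (intro positive_linear_operator_abs_le[OF R f _ _ x] C_star_scale test_fun_C_star)
        (simp add: test_fun_0)
    also have "\<dots> = M * R m (test_fun 0) x"
      using R[of m] x test_fun_C_star unfolding positive_linear_operator_def by blast
    also have "\<dots> \<le> M * sup_norm (R m (test_fun 0))"
    proof (intro mult_left_mono \<open>M \<ge> 0\<close>)
      have "bounded (R m (test_fun 0) ` {0..})"
        using R[of m] test_fun_C_star unfolding positive_linear_operator_def B_star_def by blast
      from le_sup_norm[OF this x] show "R m (test_fun 0) x \<le> sup_norm (R m (test_fun 0))"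
        by linarith
    qed
    finally have "\<bar>R m f x\<bar> * (y ^ m / fact m) \<le> M * sup_norm (R m (test_fun 0)) * (y ^ m / fact m)"
      using y by (intro mult_right_mono) auto
    then show ?thesis
      using y by (simp add: abs_mult mult.assoc)
  qed
  have sb: "summable ?b" using summable by (rule summable_mult)
  show "summable (\<lambda>m. R m f x * (y ^ m / fact m))"
    using le by (intro summable_comparison_test'[OF sb]) auto
  have "norm (\<Sum>m. R m f x * (y ^ m / fact m)) \<le> (\<Sum>m. ?b m)"
    by (rule norm_suminf_le[OF le sb])
  then show "\<bar>\<Sum>m. R m f x * (y ^ m / fact m)\<bar>
      \<le> M * (\<Sum>m. sup_norm (R m (test_fun 0)) * (y ^ m / fact m))"
    by (simp only: suminf_mult[OF summable] real_norm_def)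
qed

text \<open>The weights are the Poisson probabilities with parameter \<open>y\<close>; they sum to
  1, so this is an average of the values \<open>R m f x\<close>.\<close>

definition borel_mean :: "(real \<Rightarrow> real) \<Rightarrow> real \<Rightarrow> real" where
  "borel_mean f x = exp (- y) * (\<Sum>m. R m f x * (y ^ m / fact m))"

lemma summable_operator_series:
  assumes "f \<in> C_star" "x \<ge> 0"
  shows "summable (\<lambda>m. R m f x * (y ^ m / fact m))"
proof -
  obtain M where "\<And>t. t \<ge> 0 \<Longrightarrow> \<bar>f t\<bar> \<le> M"
    using C_star_bounded[OF assms(1)] by (auto simp: bounded_iff)
  then show ?thesis using operator_series_bounds(1) assms by blast
qed

lemma operator_error_series:
  assumes f: "f \<in> C_star" and x: "x \<ge> 0"
  shows "(\<Sum>m. (R m f x - f x) * (y ^ m / fact m)) = (\<Sum>m. R m f x * (y ^ m / fact m)) - f x * exp y"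
proof -
  have "(\<lambda>m. R m f x * (y ^ m / fact m) - f x * (y ^ m / fact m))
      sums ((\<Sum>m. R m f x * (y ^ m / fact m)) - f x * exp y)"
    by (intro sums_diff sums_mult sums_exp_fact summable_sums summable_operator_series f x)
  then show ?thesis
    by (simp only: left_diff_distrib sums_iff)
qed

lemma borel_mean_error:
  assumes "f \<in> C_star" "x \<ge> 0"
  shows "exp (- y) * (\<Sum>m. (R m f x - f x) * (y ^ m / fact m)) = borel_mean f x - f x"
  unfolding operator_error_series[OF assms] borel_mean_def
  by (simp add: right_diff_distrib exp_minus)

text \<open>The point \<open>x\<close> is frozen, so the value at each argument is the constant \<open>borel_mean f x\<close>; this
  avoids showing that \<open>borel_mean f\<close> has a limit at infinity.\<close>

lemma borel_mean_positive_linear: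
  assumes x: "x \<ge> 0"
  shows "positive_linear_operator (\<lambda>f _. borel_mean f x)"
  unfolding positive_linear_operator_def
proof (intro conjI ballI allI impI)
  fix f assume f: "f \<in> C_star"
  show "(\<lambda>_. borel_mean f x) \<in> B_star"
    by (auto simp: B_star_def image_constant_conv intro: tendsto_const)
  show "borel_mean (\<lambda>t. c * f t) x = c * borel_mean f x" for c
  proof -
    have "R m (\<lambda>t. c * f t) x = c * R m f x" for m
      using R[of m] f x unfolding positive_linear_operator_def by blast
    then show ?thesis
      using suminf_mult[OF summable_operator_series[OF f x], of c]
      by (simp add: borel_mean_def mult.assoc)
  qed
  show "borel_mean (\<lambda>t. f t + g t) x = borel_mean f x + borel_mean g x" if g: "g \<in> C_star" for g
  proof -
    have "R m (\<lambda>t. f t + g t) x = R m f x + R m g x" for m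
      using R[of m] f g x unfolding positive_linear_operator_def by blast
    then show ?thesis
      using suminf_add[OF summable_operator_series[OF f x] summable_operator_series[OF g x]]
      by (simp only: borel_mean_def distrib_right flip: distrib_left)
  qed
  show "0 \<le> borel_mean f x" if "\<forall>t\<ge>0. 0 \<le> f t"
  proof -
    have "R m f x \<ge> 0" for m
      using R[of m] f x that unfolding positive_linear_operator_def by blast
    then show ?thesis
      unfolding borel_mean_def using y
      by (intro mult_nonneg_nonneg suminf_nonneg summable_operator_series[OF f x]) auto
  qed
qed

text \<open>The work lies in showing that the error function is bounded on [0, infinity), without
  which its \<open>sup_norm\<close> would not control its values.\<close>

lemma borel_mean_error_le_sup_norm:
  assumes f: "f \<in> C_star" and x: "x \<ge> 0"
  shows "\<bar>borel_mean f x - f x\<bar>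
    \<le> exp (- y) * sup_norm (\<lambda>x. \<Sum>m. (R m f x - f x) * (y ^ m / fact m))"
proof -
  let ?h = "\<lambda>x. \<Sum>m. (R m f x - f x) * (y ^ m / fact m)"
  let ?S = "\<Sum>m. sup_norm (R m (test_fun 0)) * (y ^ m / fact m)"
  obtain M where M: "\<And>t. t \<ge> 0 \<Longrightarrow> \<bar>f t\<bar> \<le> M"
    using C_star_bounded[OF f] by (auto simp: bounded_iff)
  have "\<bar>?h t\<bar> \<le> M * ?S + M * exp y" if t: "t \<ge> 0" for t
  proof -
    have "?h t = (\<Sum>m. R m f t * (y ^ m / fact m)) - f t * exp y"
      by (rule operator_error_series[OF f t])
    moreover have "\<bar>f t * exp y\<bar> \<le> M * exp y"
      using M[OF t] by (simp add: abs_mult)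
    moreover have "\<bar>\<Sum>m. R m f t * (y ^ m / fact m)\<bar> \<le> M * ?S"
      by (rule operator_series_bounds(2)[OF f t M])
    ultimately show ?thesis by linarith
  qed
  then have "bounded (?h ` {0..})"
    by (auto simp: bounded_iff)
  from le_sup_norm[OF this x] have "exp (- y) * \<bar>?h x\<bar> \<le> exp (- y) * sup_norm ?h"
    by simp
  then show ?thesis
    by (simp add: abs_mult flip: borel_mean_error[OF f x])
qed

text \<open>This leads back from a pointwise bound uniform in x to the norm in the theorem. The
  supremum is bounded first, by \<open>exp y * c\<close>, and scaled afterwards.\<close>

lemma sup_norm_error_le:
  assumes f: "f \<in> C_star" and le: "\<And>x. x \<ge> 0 \<Longrightarrow> \<bar>borel_mean f x - f x\<bar> \<le> c"
  shows "exp (- y) * sup_norm (\<lambda>x. \<Sum>m. (R m f x - f x) * (y ^ m / fact m)) \<le> c"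
proof -
  have "sup_norm (\<lambda>x. \<Sum>m. (R m f x - f x) * (y ^ m / fact m)) \<le> exp y * c"
  proof (rule sup_norm_le)
    fix x :: real assume x: "x \<ge> 0"
    have "exp (- y) * \<bar>\<Sum>m. (R m f x - f x) * (y ^ m / fact m)\<bar> \<le> c"
      using le[OF x] by (simp add: abs_mult flip: borel_mean_error[OF f x])
    then show "\<bar>\<Sum>m. (R m f x - f x) * (y ^ m / fact m)\<bar> \<le> exp y * c"
      by (simp add: exp_minus field_simps)
  qed
  then show ?thesis
    by (simp add: exp_minus field_simps)
qed

end

section \<open>Passage to the limit as y tends to infinity\<close>

theorem corollary1:
  fixes R :: "nat \<Rightarrow> (real \<Rightarrow> real) \<Rightarrow> real \<Rightarrow> real"
  assumes "\<And>m. positive_linear_operator (R m)"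
    and "\<And>y::real. y > 0 \<Longrightarrow> summable (\<lambda>m. sup_norm (R m (test_fun 0)) * (y ^ m / fact m))"
    and "\<And>\<nu>. \<nu> \<in> {0, 1, 2} \<Longrightarrow>
      ((\<lambda>y. exp (- y) *
          sup_norm (\<lambda>x. \<Sum>m. (R m (test_fun \<nu>) x - test_fun \<nu> x) * (y ^ m / fact m)))
        \<longlongrightarrow> 0) at_top"
  shows "\<forall>\<phi>\<in>C_star.
      ((\<lambda>y. exp (- y) *
          sup_norm (\<lambda>x. \<Sum>m. (R m \<phi> x - \<phi> x) * (y ^ m / fact m)))
        \<longlongrightarrow> 0) at_top"
proof (intro ballI tendstoI)
  fix \<phi> and e :: real assume \<phi>: "\<phi> \<in> C_star" and "e > 0"
  define E where "E f y = exp (- y) * sup_norm (\<lambda>x. \<Sum>m. (R m f x - f x) * (y ^ m / fact m))" for f y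
  \<comment> \<open>Half of \<open>e\<close> is spent here; the other half is left for the test
    function errors. \<open>C\<close> is fixed before y, so multiplying those errors by it does not
    affect their limit 0.\<close>
  obtain C where "C \<ge> 0" and C: "\<And>T x. positive_linear_operator T \<Longrightarrow> x \<ge> 0 \<Longrightarrow>
       \<bar>T \<phi> x - \<phi> x\<bar> \<le> e / 2 + C * (\<Sum>\<nu>\<le>2. \<bar>T (test_fun \<nu>) x - test_fun \<nu> x\<bar>)"
    using korovkin_estimate[OF \<phi>, of "e / 2"] \<open>e > 0\<close> by auto
  have bound: "\<bar>E \<phi> y\<bar> \<le> e / 2 + C * (\<Sum>\<nu>\<le>2. E (test_fun \<nu>) y)" if y: "y > 0" for y
  proof -
    note hyps = assms(1) y assms(2)[OF y]
    have "\<bar>borel_mean R y \<phi> x - \<phi> x\<bar> \<le> e / 2 + C * (\<Sum>\<nu>\<le>2. E (test_fun \<nu>) y)" if x: "x \<ge> 0" for x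
    proof -
      have "(\<Sum>\<nu>\<le>2. \<bar>borel_mean R y (test_fun \<nu>) x - test_fun \<nu> x\<bar>) \<le> (\<Sum>\<nu>\<le>2. E (test_fun \<nu>) y)"
        unfolding E_def
        by (intro sum_mono borel_mean_error_le_sup_norm[OF hyps] test_fun_C_star x)
      from mult_left_mono[OF this \<open>C \<ge> 0\<close>] C[OF borel_mean_positive_linear[OF hyps x] x]
      show ?thesis by linarith
    qed
    then have "E \<phi> y \<le> e / 2 + C * (\<Sum>\<nu>\<le>2. E (test_fun \<nu>) y)"
      unfolding E_def[of \<phi>] by (intro sup_norm_error_le[OF hyps \<phi>])
    \<comment> \<open>\<open>E\<close> dominates the absolute error at the point 0.\<close>
    moreover have "0 \<le> E \<phi> y"
      using borel_mean_error_le_sup_norm[OF hyps \<phi>, of 0] unfolding E_def by linarith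
    ultimately show ?thesis by simp
  qed
  have "(E (test_fun \<nu>) \<longlongrightarrow> 0) at_top" if "\<nu> \<le> 2" for \<nu>
    using assms(3)[of \<nu>] that unfolding E_def by (auto simp: le_Suc_eq numeral_2_eq_2)
  then have "((\<lambda>y. \<Sum>\<nu>\<le>2. E (test_fun \<nu>) y) \<longlongrightarrow> 0) at_top"
    by (intro tendsto_null_sum) auto
  then have "((\<lambda>y. e / 2 + C * (\<Sum>\<nu>\<le>2. E (test_fun \<nu>) y)) \<longlongrightarrow> e / 2 + C * 0) at_top"
    by (intro tendsto_intros)
  then have "\<forall>\<^sub>F y in at_top. e / 2 + C * (\<Sum>\<nu>\<le>2. E (test_fun \<nu>) y) < e"
    by (rule order_tendstoD(2)) (use \<open>e > 0\<close> in simp)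
  then have "\<forall>\<^sub>F y in at_top. dist (E \<phi> y) 0 < e"
    using eventually_gt_at_top[of 0]
  proof eventually_elim
    case (elim y)
    then show ?case using bound[of y] by simp
  qed
  then show "\<forall>\<^sub>F y in at_top. dist (exp (- y) *
      sup_norm (\<lambda>x. \<Sum>m. (R m \<phi> x - \<phi> x) * (y ^ m / fact m))) 0 < e"
    by (simp only: E_def)
qed

end
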